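(* Let $\Omega$ be a domain in $\mathbb{R}^m$, let $u, v \in C^2(\Omega)$ be real-valued functions and let $\vec F=(F_1,\dots,F_m) \in C^1(\Omega)$ be a vector field on $\Omega$. Suppose that both $N_{\vec F}(u) = N_{\vec F}(v)$ and $\nabla N_{\vec F}(u) = \nabla N_{\vec F}(v)$ hold at one point $p \in \Omega \setminus [S_{\vec F}(u) \cup S_{\vec F}(v)]$. Assume $$ m \ge \operatorname{rank}(h_{IJ}(p)) \ge 3. $$ Then $\nabla u = \nabla v$ at $p$.
   Context: For a real function $w$ on $\Omega$, the singular set is $S_{\vec F}(w) := \{p\in\Omega : (\nabla w+\vec F)(p)=0\}$. Off $S_{\vec F}(w)$ the horizontal normal is $N_{\vec F}(w) := \frac{\nabla w+\vec F}{|\nabla w+\vec F|}$, a unit vector field; $\nabla N_{\vec F}(w)$ denotes the collection of all first partial derivatives of its components. $h_{IJ} := \partial_I F_J - \partial_J F_I$ for $1\le I,J\le m$, and $(h_{IJ}(p))$ is the corresponding $m\times m$ matrix at $p$. The integer $m$ need not be even. *)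

theory Defs
  imports "HOL-Analysis.Analysis"
begin

text \<open>
  Functions on an open set \<open>\<Omega>\<close> of \<open>\<real>\<^sup>m\<close> are represented by total functions on \<^typ>\<open>real ^ 'm\<close>.
  Everything below is evaluated at points of \<open>\<Omega>\<close> only, where the partial derivatives do not
  depend on the values outside \<open>\<Omega>\<close>.
\<close>

definition partial_deriv :: "'m::finite \<Rightarrow> (real ^ 'm \<Rightarrow> real) \<Rightarrow> real ^ 'm \<Rightarrow> real" where
  "partial_deriv i f x = deriv (\<lambda>t. f (x + t *\<^sub>R axis i 1)) 0"

text \<open>
  The definitions of \<open>C\<^sup>1\<close> and \<open>C\<^sup>2\<close> are meant for open \<open>\<Omega>\<close>. Total differentiability is
  included to guarantee that the partial derivatives exist (\<^const>\<open>deriv\<close> is total); on an open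
  set it adds nothing to the existence and continuity of all partial derivatives.
\<close>

definition C1_on :: "(real ^ 'm::finite) set \<Rightarrow> (real ^ 'm \<Rightarrow> real) \<Rightarrow> bool" where
  "C1_on \<Omega> f \<longleftrightarrow> f differentiable_on \<Omega> \<and> (\<forall>i. continuous_on \<Omega> (partial_deriv i f))"

definition C2_on :: "(real ^ 'm::finite) set \<Rightarrow> (real ^ 'm \<Rightarrow> real) \<Rightarrow> bool" where
  "C2_on \<Omega> f \<longleftrightarrow> C1_on \<Omega> f \<and> (\<forall>i. C1_on \<Omega> (partial_deriv i f))"

definition C1_field_on :: "(real ^ 'm::finite) set \<Rightarrow> (real ^ 'm \<Rightarrow> real ^ 'm) \<Rightarrow> bool" where
  "C1_field_on \<Omega> F \<longleftrightarrow> (\<forall>i. C1_on \<Omega> (\<lambda>x. F x $ i))"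

definition gradient :: "(real ^ 'm::finite \<Rightarrow> real) \<Rightarrow> real ^ 'm \<Rightarrow> real ^ 'm" where
  "gradient w x = (\<chi> i. partial_deriv i w x)"

definition field_gradient :: "(real ^ 'm::finite \<Rightarrow> real ^ 'm) \<Rightarrow> real ^ 'm \<Rightarrow> real ^ 'm ^ 'm" where
  "field_gradient V x = (\<chi> i. gradient (\<lambda>y. V y $ i) x)"

definition singular_set ::
  "(real ^ 'm::finite) set \<Rightarrow> (real ^ 'm \<Rightarrow> real ^ 'm) \<Rightarrow> (real ^ 'm \<Rightarrow> real) \<Rightarrow> (real ^ 'm) set" where
  "singular_set \<Omega> F w = {p \<in> \<Omega>. gradient w p + F p = 0}"

definition horizontal_normal ::
  "(real ^ 'm::finite \<Rightarrow> real ^ 'm) \<Rightarrow> (real ^ 'm \<Rightarrow> real) \<Rightarrow> real ^ 'm \<Rightarrow> real ^ 'm" where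
  "horizontal_normal F w p = (gradient w p + F p) /\<^sub>R norm (gradient w p + F p)"

definition curl_matrix :: "(real ^ 'm::finite \<Rightarrow> real ^ 'm) \<Rightarrow> real ^ 'm \<Rightarrow> real ^ 'm ^ 'm" where
  "curl_matrix F p =
    (\<chi> I J. partial_deriv I (\<lambda>x. F x $ J) p - partial_deriv J (\<lambda>x. F x $ I) p)"

end

theory Submission
  imports Defs
begin

text \<open>
  Near \<open>p\<close> write \<open>\<nabla>w + F = a N\<close> with \<open>a = |\<nabla>w + F|\<close> and \<open>N\<close> the horizontal normal, for
  \<open>w = u\<close> and \<open>w = v\<close>. Second derivatives commute, so \<open>\<nabla>w\<close> is curl free, and taking the curl
  of both sides at \<open>p\<close> gives, in the language of forms,
  \<open>h = da \<and> N + a dN\<close> (lemma \<open>curl_matrix_eq\<close>).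

  The 2-form \<open>h\<close> depends on \<open>F\<close> only, and \<open>N\<close> and \<open>dN\<close> at \<open>p\<close> are the same for \<open>u\<close> and \<open>v\<close> by
  assumption. If the two lengths \<open>a\<close> and \<open>b\<close> differed at \<open>p\<close>, subtracting
  \<open>h = da \<and> N + a dN = db \<and> N + b dN\<close> would express \<open>dN\<close>, and then \<open>h\<close> itself, as
  \<open>c \<and> N\<close> for some covector \<open>c\<close>. Such a matrix has rank at most 2 (lemma
  \<open>rank_wedge_le_2\<close>), against the assumption. Hence \<open>a = b\<close> at \<open>p\<close>, so \<open>\<nabla>u + F = a N = \<nabla>v + F\<close>.
\<close>

section \<open>Partial derivatives\<close>

lemma partial_deriv_eqI:
  assumes "((\<lambda>t. f (x + t *\<^sub>R axis i 1)) has_real_derivative D) (at 0)"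
  shows "partial_deriv i f x = D"
  using assms unfolding partial_deriv_def by (rule DERIV_imp_deriv)

lemma has_real_derivative_partial_deriv:
  assumes "f differentiable (at x)"
  shows "((\<lambda>t. f (x + t *\<^sub>R axis i 1)) has_real_derivative partial_deriv i f x) (at 0)"
proof -
  have "(\<lambda>t. f (x + t *\<^sub>R axis i 1)) differentiable (at (0::real))"
    using differentiable_chain_at[of "\<lambda>t. x + t *\<^sub>R axis i 1" 0 f] assms
    by (simp add: o_def)
  then obtain D where D: "((\<lambda>t. f (x + t *\<^sub>R axis i 1)) has_real_derivative D) (at 0)"
    by (auto simp: real_differentiable_def)
  with partial_deriv_eqI[OF D] show ?thesis by simp
qed

lemma has_real_derivative_along_axis:
  assumes "f differentiable (at (x + t *\<^sub>R axis i 1))"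
  shows "((\<lambda>s. f (x + s *\<^sub>R axis i 1)) has_real_derivative
           partial_deriv i f (x + t *\<^sub>R axis i 1)) (at t)"
proof -
  have "((\<lambda>s. f (x + (t + s) *\<^sub>R axis i 1)) has_real_derivative
           partial_deriv i f (x + t *\<^sub>R axis i 1)) (at 0)"
    using has_real_derivative_partial_deriv[OF assms] by (simp add: algebra_simps)
  then show ?thesis
    using DERIV_at_within_shift[of "\<lambda>s. f (x + s *\<^sub>R axis i 1)" _ t 0 UNIV] by simp
qed

lemma partial_deriv_add:
  assumes "f differentiable (at x)" "g differentiable (at x)"
  shows "partial_deriv i (\<lambda>y. f y + g y) x = partial_deriv i f x + partial_deriv i g x"
  by (rule partial_deriv_eqI)
     (intro DERIV_add has_real_derivative_partial_deriv assms)

lemma partial_deriv_mult: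
  assumes "f differentiable (at x)" "g differentiable (at x)"
  shows "partial_deriv i (\<lambda>y. f y * g y) x = partial_deriv i f x * g x + f x * partial_deriv i g x"
proof (rule partial_deriv_eqI)
  show "((\<lambda>t. f (x + t *\<^sub>R axis i 1) * g (x + t *\<^sub>R axis i 1)) has_real_derivative
          partial_deriv i f x * g x + f x * partial_deriv i g x) (at 0)"
    using DERIV_mult[OF has_real_derivative_partial_deriv[OF assms(1)]
        has_real_derivative_partial_deriv[OF assms(2)]]
    by (simp add: algebra_simps)
qed

lemma C1_on_imp_differentiable:
  assumes "C1_on \<Omega> f" "open \<Omega>" "x \<in> \<Omega>"
  shows "f differentiable (at x)"
  using assms by (simp add: C1_on_def differentiable_on_eq_differentiable_at)

section \<open>Symmetry of second derivatives\<close>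

text \<open>
  The mean value theorem, applied to the first variable and then to the second, turns the second
  difference of \<open>w\<close> over a small square into a mixed derivative at some point of that square.
  The second difference does not change when \<open>i\<close> and \<open>j\<close> are swapped, and this will yield the
  symmetry.
\<close>
lemma second_difference_eq_mixed_deriv:
  fixes w :: "real ^ 'm::finite \<Rightarrow> real"
  assumes "C2_on \<Omega> w" "open \<Omega>" "ball p (2 * h) \<subseteq> \<Omega>" "0 < k" "k < h"
  shows "\<exists>q \<in> ball p (2 * h).
           w (p + k *\<^sub>R axis i 1 + k *\<^sub>R axis j 1) - w (p + k *\<^sub>R axis i 1)
             - w (p + k *\<^sub>R axis j 1) + w p
           = k\<^sup>2 * partial_deriv j (partial_deriv i w) q"
proof -
  have in_ball: "p + s *\<^sub>R axis i 1 + t *\<^sub>R axis j 1 \<in> ball p (2 * h)"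
    if "0 \<le> s" "s \<le> k" "0 \<le> t" "t \<le> k" for s t
  proof -
    have "norm (s *\<^sub>R axis i 1 + t *\<^sub>R axis j 1 :: real ^ 'm) \<le> s + t"
      using norm_triangle_ineq[of "s *\<^sub>R axis i 1 :: real ^ 'm" "t *\<^sub>R axis j 1"] that
      by simp
    also have "\<dots> < 2 * h" using that assms by simp
    finally have "norm (- (s *\<^sub>R axis i 1 + t *\<^sub>R axis j 1) :: real ^ 'm) < 2 * h"
      by (simp only: norm_minus_cancel)
    then show ?thesis by (simp add: dist_norm algebra_simps)
  qed
  have dw: "w differentiable (at x)" if "x \<in> ball p (2 * h)" for x
    using assms that by (auto simp: C2_on_def intro: C1_on_imp_differentiable)
  have dwi: "partial_deriv i w differentiable (at x)" if "x \<in> ball p (2 * h)" for x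
    using assms that C1_on_imp_differentiable[of \<Omega> "partial_deriv i w"]
    by (auto simp: C2_on_def)
  define \<phi> where "\<phi> = (\<lambda>s. w (p + k *\<^sub>R axis j 1 + s *\<^sub>R axis i 1) - w (p + s *\<^sub>R axis i 1))"
  define \<phi>' where "\<phi>' = (\<lambda>s. partial_deriv i w (p + k *\<^sub>R axis j 1 + s *\<^sub>R axis i 1)
                         - partial_deriv i w (p + s *\<^sub>R axis i 1))"
  have "(\<phi> has_real_derivative \<phi>' s) (at s)" if "0 \<le> s" "s \<le> k" for s
    unfolding \<phi>_def \<phi>'_def
    using in_ball[of s k] in_ball[of s 0] that assms(4)
    by (intro DERIV_diff has_real_derivative_along_axis dw) (simp_all add: algebra_simps)
  then obtain s where s: "0 < s" "s < k" "\<phi> k - \<phi> 0 = (k - 0) * \<phi>' s"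
    using MVT2[OF assms(4), of \<phi> \<phi>'] by blast
  define x where "x = p + s *\<^sub>R axis i 1"
  have "((\<lambda>t. partial_deriv i w (x + t *\<^sub>R axis j 1)) has_real_derivative
           partial_deriv j (partial_deriv i w) (x + t *\<^sub>R axis j 1)) (at t)"
    if "0 \<le> t" "t \<le> k" for t
    using in_ball[of s t] s that unfolding x_def
    by (intro has_real_derivative_along_axis dwi) simp_all
  then obtain t where t: "0 < t" "t < k"
    "partial_deriv i w (x + k *\<^sub>R axis j 1) - partial_deriv i w (x + 0 *\<^sub>R axis j 1)
       = (k - 0) * partial_deriv j (partial_deriv i w) (x + t *\<^sub>R axis j 1)"
    using MVT2[OF assms(4), of "\<lambda>t. partial_deriv i w (x + t *\<^sub>R axis j 1)"
        "\<lambda>t. partial_deriv j (partial_deriv i w) (x + t *\<^sub>R axis j 1)"] by blast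
  have "\<phi>' s = k * partial_deriv j (partial_deriv i w) (x + t *\<^sub>R axis j 1)"
    using t(3) by (simp add: \<phi>'_def x_def algebra_simps)
  then have "\<phi> k - \<phi> 0 = k\<^sup>2 * partial_deriv j (partial_deriv i w) (x + t *\<^sub>R axis j 1)"
    using s(3) by (simp add: power2_eq_square)
  moreover have "\<phi> k - \<phi> 0 = w (p + k *\<^sub>R axis i 1 + k *\<^sub>R axis j 1) - w (p + k *\<^sub>R axis i 1)
             - w (p + k *\<^sub>R axis j 1) + w p"
    by (simp add: \<phi>_def algebra_simps)
  moreover have "x + t *\<^sub>R axis j 1 \<in> ball p (2 * h)"
    using in_ball[of s t] s t by (simp add: x_def)
  ultimately show ?thesis by (metis (no_types, lifting))
qed

lemma mixed_partial_derivs_commute: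
  fixes w :: "real ^ 'm::finite \<Rightarrow> real"
  assumes "C2_on \<Omega> w" "open \<Omega>" "p \<in> \<Omega>"
  shows "partial_deriv i (partial_deriv j w) p = partial_deriv j (partial_deriv i w) p"
proof -
  let ?d = "\<lambda>i j. partial_deriv j (partial_deriv i w)"
  have near: "\<exists>\<delta>>0. \<forall>q\<in>ball p \<delta>. \<bar>?d i j q - ?d i j p\<bar> < \<epsilon>" if "\<epsilon> > 0" for i j \<epsilon>
  proof -
    have "continuous_on \<Omega> (?d i j)" using assms(1) by (simp add: C2_on_def C1_on_def)
    then have "isCont (?d i j) p"
      using assms by (simp add: continuous_on_eq_continuous_at)
    then show ?thesis using that
      by (force simp: continuous_at_eps_delta dist_real_def dist_commute)
  qed
  have "\<bar>?d j i p - ?d i j p\<bar> \<le> \<epsilon>" if \<epsilon>: "\<epsilon> > 0" for \<epsilon>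
  proof -
    obtain \<delta>1 where \<delta>1: "\<delta>1 > 0" "\<forall>q\<in>ball p \<delta>1. \<bar>?d i j q - ?d i j p\<bar> < \<epsilon> / 2"
      using near[where i = i and j = j and \<epsilon> = "\<epsilon> / 2"] half_gt_zero[OF \<epsilon>] by blast
    obtain \<delta>2 where \<delta>2: "\<delta>2 > 0" "\<forall>q\<in>ball p \<delta>2. \<bar>?d j i q - ?d j i p\<bar> < \<epsilon> / 2"
      using near[where i = j and j = i and \<epsilon> = "\<epsilon> / 2"] half_gt_zero[OF \<epsilon>] by blast
    obtain r where r: "r > 0" "ball p r \<subseteq> \<Omega>"
      using assms by (auto simp: open_contains_ball)
    define h where "h = min r (min \<delta>1 \<delta>2) / 2"
    define k where "k = h / 2"
    have h: "h > 0" "2 * h \<le> r" "2 * h \<le> \<delta>1" "2 * h \<le> \<delta>2"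
      using r \<delta>1 \<delta>2 by (auto simp: h_def)
    then have sub: "ball p (2 * h) \<subseteq> \<Omega>" and k: "0 < k" "k < h"
      using r subset_ball[of "2 * h" r p] by (auto simp: k_def)
    obtain q1 where q1: "q1 \<in> ball p (2 * h)"
      "w (p + k *\<^sub>R axis i 1 + k *\<^sub>R axis j 1) - w (p + k *\<^sub>R axis i 1)
             - w (p + k *\<^sub>R axis j 1) + w p = k\<^sup>2 * ?d i j q1"
      using second_difference_eq_mixed_deriv[OF assms(1,2) sub k] by blast
    obtain q2 where q2: "q2 \<in> ball p (2 * h)"
      "w (p + k *\<^sub>R axis j 1 + k *\<^sub>R axis i 1) - w (p + k *\<^sub>R axis j 1)
             - w (p + k *\<^sub>R axis i 1) + w p = k\<^sup>2 * ?d j i q2"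
      using second_difference_eq_mixed_deriv[OF assms(1,2) sub k] by blast
    have "k\<^sup>2 * ?d i j q1 = k\<^sup>2 * ?d j i q2"
      using q1(2) q2(2) by (simp add: algebra_simps)
    then have "?d i j q1 = ?d j i q2" using k by simp
    moreover have "\<bar>?d i j q1 - ?d i j p\<bar> < \<epsilon> / 2" "\<bar>?d j i q2 - ?d j i p\<bar> < \<epsilon> / 2"
      using \<delta>1(2) \<delta>2(2) q1(1) q2(1) h by auto
    ultimately show ?thesis by linarith
  qed
  then have "\<bar>?d j i p - ?d i j p\<bar> \<le> 0" by (rule field_le_epsilon) simp
  then show ?thesis by simp
qed

section \<open>The curl in terms of the horizontal normal\<close>

text \<open>
  In the notation of forms this is \<open>h = da \<and> N + a dN\<close>, where \<open>a N = \<nabla>w + F\<close>. The gradient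
  \<open>\<nabla>w\<close> does not contribute to the left hand side because its curl vanishes.
\<close>
lemma curl_matrix_eq:
  fixes w :: "real ^ 'm::finite \<Rightarrow> real" and F :: "real ^ 'm \<Rightarrow> real ^ 'm"
  assumes "open \<Omega>" "C2_on \<Omega> w" "C1_field_on \<Omega> F" "p \<in> \<Omega>" "p \<notin> singular_set \<Omega> F w"
  defines "a \<equiv> \<lambda>x. norm (gradient w x + F x)"
    and "N \<equiv> horizontal_normal F w"
  shows "curl_matrix F p $ i $ j =
           gradient a p $ i * N p $ j - gradient a p $ j * N p $ i
           + a p * (field_gradient N p $ j $ i - field_gradient N p $ i $ j)"
proof -
  define A where "A = (\<lambda>x. gradient w x + F x)"
  have dw: "(\<lambda>x. gradient w x $ l) differentiable (at p)" for l
    using assms by (auto simp: gradient_def C2_on_def intro: C1_on_imp_differentiable)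
  have dF: "(\<lambda>x. F x $ l) differentiable (at p)" for l
    using assms by (auto simp: C1_field_on_def intro: C1_on_imp_differentiable)
  have dA: "A differentiable (at p)"
    unfolding A_def using dw dF
    by (subst differentiable_componentwise_within)
       (auto simp: Basis_vec_def inner_axis intro!: differentiable_add)
  have A_nz: "A p \<noteq> 0" using assms(4,5) by (simp add: A_def singular_set_def)
  have a_eq: "a = (\<lambda>x. norm (A x))" by (simp add: a_def A_def)
  have da: "a differentiable (at p)"
    unfolding a_eq
    using differentiable_chain_at[OF dA differentiable_norm_at[OF A_nz]] by (simp add: o_def)
  have dN: "(\<lambda>x. N x $ l) differentiable (at p)" for l
  proof -
    have "(\<lambda>x. A x $ l) differentiable (at p)"
      unfolding A_def using dw[of l] dF[of l] by (simp add: differentiable_add)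
    moreover have "(\<lambda>x. inverse (a x)) differentiable (at p)"
      using da A_nz by (intro differentiable_inverse) (auto simp: a_eq)
    ultimately have "(\<lambda>x. inverse (a x) * A x $ l) differentiable (at p)"
      by (intro differentiable_mult)
    then show ?thesis by (simp add: N_def horizontal_normal_def a_def A_def)
  qed
  have N_eq: "N x = A x /\<^sub>R a x" for x
    by (simp only: N_def horizontal_normal_def a_def A_def)
  \<comment> \<open>This holds at every \<open>x\<close>, since both sides vanish at singular points; it can therefore be
    differentiated without restricting to a neighbourhood of \<open>p\<close>.\<close>
  have A_eq: "A x = a x *\<^sub>R N x" for x
    by (cases "A x = 0") (simp_all add: N_eq a_eq)
  have "gradient w x $ l + F x $ l = a x * N x $ l" for x l
    using arg_cong[OF A_eq, of "\<lambda>y. y $ l" x] by (simp add: A_def)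
  then have "partial_deriv k (\<lambda>x. gradient w x $ l + F x $ l) p
      = partial_deriv k (\<lambda>x. a x * N x $ l) p" for k l by simp
  then have prod: "partial_deriv k (\<lambda>x. gradient w x $ l) p + partial_deriv k (\<lambda>x. F x $ l) p
      = gradient a p $ k * N p $ l + a p * field_gradient N p $ l $ k" for k l
    by (simp add: partial_deriv_add[OF dw dF] partial_deriv_mult[OF da dN]
        field_gradient_def) (simp add: gradient_def)
  have "partial_deriv i (\<lambda>x. gradient w x $ j) p = partial_deriv j (\<lambda>x. gradient w x $ i) p"
    using mixed_partial_derivs_commute[OF assms(2,1,4), of i j] by (simp add: gradient_def)
  with prod[of i j] prod[of j i] show ?thesis
    by (simp add: curl_matrix_def algebra_simps)
qed

section \<open>The rank of a decomposable 2-form\<close>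

text \<open>Every row is a linear combination of the two vectors \<open>c\<close> and \<open>n\<close>.\<close>
lemma rank_wedge_le_2:
  fixes A :: "real ^ 'm ^ 'm" and c n :: "real ^ 'm"
  assumes "\<And>i j. A $ i $ j = c $ i * n $ j - c $ j * n $ i"
  shows "rank A \<le> 2"
proof -
  have "row i A = c $ i *\<^sub>R n - n $ i *\<^sub>R c" for i
    by (simp add: row_def vec_eq_iff assms)
  moreover have "c $ i *\<^sub>R n - n $ i *\<^sub>R c \<in> span {n, c}" for i
    by (intro span_diff span_scale span_base) simp_all
  ultimately have "rows A \<subseteq> span {n, c}" by (auto simp only: rows_def)
  then have "dim (rows A) \<le> card {n, c}"
    by (intro dim_le_card) auto
  also have "\<dots> \<le> 2" by (simp add: card_insert_if)
  finally show ?thesis by (simp add: row_rank_def)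
qed

section \<open>The gradient is determined by the horizontal normal\<close>

theorem theoremA:
  fixes \<Omega> :: "(real ^ 'm::finite) set"
    and u v :: "real ^ 'm \<Rightarrow> real"
    and F :: "real ^ 'm \<Rightarrow> real ^ 'm"
    and p :: "real ^ 'm"
  assumes "open \<Omega>" and "connected \<Omega>"
    and "C2_on \<Omega> u" and "C2_on \<Omega> v" and "C1_field_on \<Omega> F"
    and "p \<in> \<Omega> - (singular_set \<Omega> F u \<union> singular_set \<Omega> F v)"
    and "horizontal_normal F u p = horizontal_normal F v p"
    and "field_gradient (horizontal_normal F u) p = field_gradient (horizontal_normal F v) p"
    and "CARD('m) \<ge> rank (curl_matrix F p)" and "rank (curl_matrix F p) \<ge> 3"
  shows "gradient u p = gradient v p"
proof -
  define a where "a = norm (gradient u p + F p)"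
  define b where "b = norm (gradient v p + F p)"
  define \<alpha> where "\<alpha> = gradient (\<lambda>x. norm (gradient u x + F x)) p"
  define \<beta> where "\<beta> = gradient (\<lambda>x. norm (gradient v x + F x)) p"
  define n where "n = horizontal_normal F u p"
  define \<omega> where "\<omega> = (\<lambda>i j. field_gradient (horizontal_normal F u) p $ j $ i
                          - field_gradient (horizontal_normal F u) p $ i $ j)"
  have hu: "curl_matrix F p $ i $ j = \<alpha> $ i * n $ j - \<alpha> $ j * n $ i + a * \<omega> i j" for i j
    using curl_matrix_eq[OF assms(1,3,5), of p i j] assms(6)
    by (simp add: \<alpha>_def a_def n_def \<omega>_def)
  have hv: "curl_matrix F p $ i $ j = \<beta> $ i * n $ j - \<beta> $ j * n $ i + b * \<omega> i j" for i j
    using curl_matrix_eq[OF assms(1,4,5), of p i j] assms(6,7,8)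
    by (simp add: \<beta>_def b_def n_def \<omega>_def)
  have "a = b"
  proof (rule ccontr)
    assume "a \<noteq> b"
    \<comment> \<open>Eliminating \<open>\<omega>\<close>: \<open>(a - b) h = a h - b h\<close>, with \<open>h\<close> expressed through \<open>\<beta>\<close> and \<open>b\<close> in the
      first term and through \<open>\<alpha>\<close> and \<open>a\<close> in the second.\<close>
    define c where "c = (a *\<^sub>R \<beta> - b *\<^sub>R \<alpha>) /\<^sub>R (a - b)"
    have "curl_matrix F p $ i $ j = c $ i * n $ j - c $ j * n $ i" for i j
    proof -
      have "(a - b) * curl_matrix F p $ i $ j
          = a * (\<beta> $ i * n $ j - \<beta> $ j * n $ i + b * \<omega> i j)
            - b * (\<alpha> $ i * n $ j - \<alpha> $ j * n $ i + a * \<omega> i j)"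
        by (simp only: left_diff_distrib flip: hu hv)
      also have "\<dots> = (a * \<beta> $ i - b * \<alpha> $ i) * n $ j - (a * \<beta> $ j - b * \<alpha> $ j) * n $ i"
        by (simp add: algebra_simps)
      also have "\<dots> = (a - b) * (c $ i * n $ j - c $ j * n $ i)"
      proof -
        have "a * \<beta> $ l - b * \<alpha> $ l = (a - b) * c $ l" for l
          using \<open>a \<noteq> b\<close> by (simp add: c_def)
        then show ?thesis by (simp add: right_diff_distrib mult.assoc)
      qed
      finally show ?thesis using \<open>a \<noteq> b\<close> by simp
    qed
    then have "rank (curl_matrix F p) \<le> 2" by (rule rank_wedge_le_2)
    with assms(10) show False by simp
  qed
  moreover have "gradient u p + F p = a *\<^sub>R n"
    using assms(6) by (simp add: a_def n_def horizontal_normal_def singular_set_def)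
  moreover have "gradient v p + F p = b *\<^sub>R n"
    using assms(6) unfolding b_def n_def assms(7)
    by (simp add: horizontal_normal_def singular_set_def)
  ultimately show ?thesis by (metis add_right_cancel)
qed

end
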